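(* For finitely generated groups $G$ of orientation-preserving $C^2$ circle diffeomorphisms having an exceptional minimal set $\Lambda$, property $(\Lambda\star)$ does not depend on the choice of the Riemannian metric on the circle: if it holds with respect to one Riemannian metric on $S^1$, then it holds with respect to every Riemannian metric on $S^1$.
   Context: An exceptional minimal set of $G$ is a nonempty closed $G$-invariant set $\Lambda\subset S^1$, minimal for inclusion among such sets, which is homeomorphic to the Cantor set. Given a Riemannian metric on $S^1$, let $g'(x)>0$ denote the derivative of $g$ at $x$ measured in this metric. A point $x$ is non-expandable (with respect to this metric) if $g'(x)\le1$ for all $g\in G$; $\mathrm{NE}(G)$ is the set of such points. Property $(\Lambda\star)$ with respect to this metric: for every $x\in\Lambda\cap\mathrm{NE}(G)$ there exist $g_+,g_-\in G$ with $g_+(x)=g_-(x)=x$ such that, for some $\varepsilon>0$, $g_+$ has no other fixed point in $(x,x+\varepsilon)$ and $g_-$ has no other fixed point in $(x-\varepsilon,x)$. *)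

theory Defs
  imports "HOL-Analysis.Analysis" "HOL-Algebra.Bij" "HOL-Algebra.Generated_Groups"
begin

abbreviation circle :: "complex set"
  where "circle \<equiv> sphere 0 1"

definition circle_tangent_space :: "complex \<Rightarrow> complex set"
  where "circle_tangent_space x = {v. x \<bullet> v = 0}"

text \<open>The positively oriented Euclidean unit tangent vector at \<open>x\<close> is \<open>\<i> * x\<close>, the velocity of
  \<open>\<theta> \<mapsto> x * cis \<theta>\<close> at \<open>0\<close>. Its image under the differential of a circle map determines the
  differential, because tangent spaces are one-dimensional.\<close>

definition circle_velocity :: "(complex \<Rightarrow> complex) \<Rightarrow> complex \<Rightarrow> complex"
  where "circle_velocity f x = vector_derivative (\<lambda>\<theta>. f (x * cis \<theta>)) (at 0)"

definition circle_C2 :: "(complex \<Rightarrow> complex) \<Rightarrow> bool"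
  where "circle_C2 f \<longleftrightarrow>
    (\<exists>D. (\<forall>\<theta>. ((\<lambda>t. f (cis t)) has_vector_derivative D \<theta>) (at \<theta>)) \<and>
         D C1_differentiable_on UNIV)"

definition orientation_preserving :: "(complex \<Rightarrow> complex) \<Rightarrow> bool"
  where "orientation_preserving f \<longleftrightarrow>
    (\<forall>x\<in>circle. \<exists>c>0. circle_velocity f x = c *\<^sub>R (\<i> * f x))"

text \<open>Circle maps are total functions on \<^typ>\<open>complex\<close>; membership in \<^term>\<open>Bij circle\<close> makes them
  \<^const>\<open>undefined\<close> off the circle, so that they are elements of the group
  \<^term>\<open>BijGroup circle\<close> of all bijections of the circle under composition.\<close>

definition C2_diffeos :: "(complex \<Rightarrow> complex) set"
  where "C2_diffeos = {f \<in> Bij circle.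
    circle_C2 f \<and> circle_C2 (inv_into circle f) \<and> orientation_preserving f}"

definition fg_C2_circle_group :: "(complex \<Rightarrow> complex) set \<Rightarrow> bool"
  where "fg_C2_circle_group G \<longleftrightarrow>
    subgroup G (BijGroup circle) \<and> G \<subseteq> C2_diffeos \<and>
    (\<exists>S. finite S \<and> S \<subseteq> carrier (BijGroup circle) \<and> G = generate (BijGroup circle) S)"

text \<open>The middle-thirds Cantor set.\<close>

primrec cantor_stage :: "nat \<Rightarrow> real set"
  where
    "cantor_stage 0 = {0..1}"
  | "cantor_stage (Suc n) = (\<lambda>x. x / 3) ` cantor_stage n \<union> (\<lambda>x. 2 / 3 + x / 3) ` cantor_stage n"

definition cantor_set :: "real set"
  where "cantor_set = (\<Inter>n. cantor_stage n)"

definition nonempty_closed_invariant :: "(complex \<Rightarrow> complex) set \<Rightarrow> complex set \<Rightarrow> bool"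
  where "nonempty_closed_invariant G A \<longleftrightarrow>
    A \<noteq> {} \<and> A \<subseteq> circle \<and> closed A \<and> (\<forall>g\<in>G. g ` A = A)"

definition exceptional_minimal_set :: "(complex \<Rightarrow> complex) set \<Rightarrow> complex set \<Rightarrow> bool"
  where "exceptional_minimal_set G \<Lambda> \<longleftrightarrow>
    nonempty_closed_invariant G \<Lambda> \<and>
    (\<forall>A. nonempty_closed_invariant G A \<and> A \<subseteq> \<Lambda> \<longrightarrow> A = \<Lambda>) \<and>
    \<Lambda> homeomorphic cantor_set"

definition smooth_real :: "(real \<Rightarrow> real) \<Rightarrow> bool"
  where "smooth_real \<phi> \<longleftrightarrow> (\<forall>n t. (deriv ^^ n) \<phi> field_differentiable (at t))"

text \<open>A Riemannian metric is a smoothly varying inner product \<open>h x\<close> on the tangent spaces; smoothness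
  is tested on the smooth frame \<open>x \<mapsto> \<i> * x\<close>. Values of \<open>h\<close> at other arguments are irrelevant.\<close>

definition riemannian_metric :: "(complex \<Rightarrow> complex \<Rightarrow> complex \<Rightarrow> real) \<Rightarrow> bool"
  where "riemannian_metric h \<longleftrightarrow>
    (\<forall>x\<in>circle. \<forall>u\<in>circle_tangent_space x. \<forall>v\<in>circle_tangent_space x.
       h x u v = h x v u \<and>
       (\<forall>w\<in>circle_tangent_space x. \<forall>a b. h x (a *\<^sub>R u + b *\<^sub>R v) w = a * h x u w + b * h x v w) \<and>
       (u \<noteq> 0 \<longrightarrow> h x u u > 0)) \<and>
    smooth_real (\<lambda>\<theta>. h (cis \<theta>) (\<i> * cis \<theta>) (\<i> * cis \<theta>))"

text \<open>The derivative of \<open>g\<close> at \<open>x\<close> measured in the metric: the factor by which the differential of \<open>g\<close>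
  scales the \<open>h\<close>-length of tangent vectors at \<open>x\<close>.\<close>

definition metric_deriv ::
    "(complex \<Rightarrow> complex \<Rightarrow> complex \<Rightarrow> real) \<Rightarrow> (complex \<Rightarrow> complex) \<Rightarrow> complex \<Rightarrow> real"
  where "metric_deriv h g x =
    sqrt (h (g x) (circle_velocity g x) (circle_velocity g x)) / sqrt (h x (\<i> * x) (\<i> * x))"

definition NE ::
    "(complex \<Rightarrow> complex \<Rightarrow> complex \<Rightarrow> real) \<Rightarrow> (complex \<Rightarrow> complex) set \<Rightarrow> complex set"
  where "NE h G = {x \<in> circle. \<forall>g\<in>G. metric_deriv h g x \<le> 1}"

text \<open>The one-sided neighbourhoods of \<open>x\<close> are the arcs \<open>x * cis t\<close> with \<open>0 < t < \<epsilon>\<close> and with \<open>-\<epsilon> < t < 0\<close>.\<close>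

definition property_star ::
    "(complex \<Rightarrow> complex \<Rightarrow> complex \<Rightarrow> real) \<Rightarrow> (complex \<Rightarrow> complex) set \<Rightarrow> complex set \<Rightarrow> bool"
  where "property_star h G \<Lambda> \<longleftrightarrow>
    (\<forall>x \<in> \<Lambda> \<inter> NE h G. \<exists>gp\<in>G. \<exists>gm\<in>G. gp x = x \<and> gm x = x \<and>
       (\<exists>\<epsilon>>0. (\<forall>t\<in>{0<..<\<epsilon>}. gp (x * cis t) \<noteq> x * cis t) \<and>
              (\<forall>t\<in>{-\<epsilon><..<0}. gm (x * cis t) \<noteq> x * cis t)))"

end

theory Submission
  imports Defs
begin

text \<open>Two Riemannian metrics are uniformly comparable, so at a point \<open>x\<close> that is non-expandable for
  \<open>h'\<close> the \<open>h\<close>-derivatives of all \<open>g \<in> G\<close> are bounded. Let \<open>M\<close> be their supremum, choose \<open>g\<^sub>n\<close> with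
  \<open>g\<^sub>n'(x) \<rightarrow> M\<close> and let \<open>y\<close> be an accumulation point of \<open>g\<^sub>n(x)\<close>. By the chain rule \<open>f'(y) \<le> 1\<close> for
  every \<open>f\<close>, so \<open>y \<in> \<Lambda>\<close> is non-expandable for \<open>h\<close> and the fixing elements \<open>g\<^sub>+\<close>, \<open>g\<^sub>-\<close> exist at \<open>y\<close>.
  If \<open>g\<^sub>n(x) = y\<close> for some \<open>n\<close>, they can be conjugated to \<open>x\<close>. Otherwise the points \<open>g\<^sub>n(x)\<close>
  approach \<open>y\<close> without reaching it; iterating \<open>g\<^sub>+\<close>, \<open>g\<^sub>-\<close> or an inverse pushes them a definite distance
  away, and \<open>C\<^sup>2\<close> distortion control makes the derivatives of these iterates unbounded, which
  contradicts the bound on derivatives at \<open>x\<close>.\<close>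

section \<open>Derivative growth along orbits leaving a fixed point of a real map\<close>

text \<open>Bounded distortion: an orbit starting close to \<open>a\<close> opens with a tiny step
  \<open>F t - t\<close>, yet takes a step of definite length once it reaches a fixed fundamental
  domain. The derivative of the iterate is comparable to the ratio of the two steps, hence exceeds
  any \<open>K\<close>.\<close>

lemma repelling_right:
  fixes F c d :: "real \<Rightarrow> real"
  assumes F: "\<And>t. (F has_real_derivative c t) (at t)"
    and c: "\<And>t. (c has_real_derivative d t) (at t)"
    and d: "continuous_on UNIV d"
    and pos: "\<And>t. 0 < c t"
    and fixa: "F a = a" and "0 < \<epsilon>"
    and rep: "\<And>t. a < t \<Longrightarrow> t < a + \<epsilon> \<Longrightarrow> t < F t"
  shows "\<exists>\<delta>>0. \<forall>t. a < t \<and> t < a + \<delta> \<longrightarrow> (\<exists>k. K \<le> (\<Prod>j<k. c ((F ^^ j) t)))"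
proof -
  have contF: "continuous_on S F" for S
    by (rule DERIV_continuous_on[OF has_field_derivative_at_within[OF F]])
  have contc: "continuous_on S c" for S
    by (rule DERIV_continuous_on[OF has_field_derivative_at_within[OF c]])
  have mono: "F s < F t" if "s < t" for s t
    using that by (rule DERIV_pos_imp_increasing) (use F pos in auto)
  have "isCont F a"
    by (rule DERIV_isCont[OF F])
  then have "\<exists>e>0. \<forall>t. \<bar>t - a\<bar> < e \<longrightarrow> \<bar>F t - F a\<bar> < \<epsilon>"
    using \<open>0 < \<epsilon>\<close> unfolding continuous_at_eps_delta dist_real_def by simp
  then obtain e where e: "e > 0" "\<And>t. \<bar>t - a\<bar> < e \<Longrightarrow> \<bar>F t - F a\<bar> < \<epsilon>"
    by auto
  \<comment> \<open>Halving puts both \<open>b\<close> and \<open>F b\<close> strictly inside the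
    range of \<open>rep\<close>, so \<open>[b, F b]\<close> is a fundamental domain that no orbit
    jumps over.\<close>
  define b where "b = a + min e \<epsilon> / 2"
  have b: "a < b" "b < a + \<epsilon>" "b < F b"
    using e \<open>0 < \<epsilon>\<close> rep[of b] by (auto simp: b_def min_def)
  have Fb: "F b < a + \<epsilon>"
    using e(2)[of b] e(1) \<open>0 < \<epsilon>\<close> fixa by (auto simp: b_def min_def split: if_splits)
  obtain u where u: "u \<in> {b..F b}" "\<And>v. v \<in> {b..F b} \<Longrightarrow> F u - u \<le> F v - v"
    using continuous_attains_inf[OF compact_Icc[of b "F b"] _ continuous_on_diff[OF contF continuous_on_id]] b
    by (auto simp del: atLeastAtMost_iff)
  \<comment> \<open>The shortest step taken from the fundamental domain.\<close>
  define \<eta> where "\<eta> = F u - u"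
  have "\<eta> > 0"
    using rep[of u] u(1) b Fb by (auto simp: \<eta>_def)
  obtain w where w: "\<And>v. v \<in> {a..F b} \<Longrightarrow> c w \<le> c v"
    using continuous_attains_inf[OF compact_Icc[of a "F b"] _ contc] b
    by (auto simp del: atLeastAtMost_iff)
  have "continuous_on {a..F b} (\<lambda>t. \<bar>d t\<bar>)"
    by (intro continuous_intros continuous_on_subset[OF d]) auto
  then obtain B where B: "\<And>v. v \<in> {a..F b} \<Longrightarrow> \<bar>d v\<bar> \<le> B"
    using continuous_attains_sup[of "{a..F b}" "\<lambda>t. \<bar>d t\<bar>"] b by fastforce
  \<comment> \<open>\<open>c w\<close> is the minimum of \<open>c\<close> and \<open>B\<close>
    bounds \<open>\<bar>d\<bar>\<close> on \<open>[a, F b]\<close>, so \<open>C\<close> bounds the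
    logarithmic derivative of \<open>c\<close> there.\<close>
  define C where "C = B / c w"
  have "C \<ge> 0"
    using B[of a] b pos[of w] by (auto simp: C_def)
  have distortion: "c \<xi> \<le> c s * exp (C * (\<xi> - s))" if "a \<le> s" "s \<le> \<xi>" "\<xi> \<le> F b" for s \<xi>
  proof -
    have "\<bar>c \<xi> - c s\<bar> \<le> B * \<bar>\<xi> - s\<bar>"
      using field_differentiable_bound[of "{a..F b}" c d B \<xi> s] that B c
      by (auto intro: has_field_derivative_at_within)
    then have "c \<xi> \<le> c s + B * (\<xi> - s)"
      using that by auto
    also have "B * (\<xi> - s) = c w * (C * (\<xi> - s))"
      using pos[of w] by (auto simp: C_def)
    also have "\<dots> \<le> c s * (C * (\<xi> - s))"
      using w[of s] that \<open>C \<ge> 0\<close> by (intro mult_right_mono) auto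
    also have "c s + \<dots> = c s * (1 + C * (\<xi> - s))"
      by (simp add: algebra_simps)
    also have "\<dots> \<le> c s * exp (C * (\<xi> - s))"
      using pos[of s] by (intro mult_left_mono exp_ge_add_one_self) auto
    finally show ?thesis by simp
  qed
  \<comment> \<open>Fitted to the final estimate: \<open>P * exp (C * (F b - a)) * \<kappa>\<close>
    equals \<open>P * \<eta> / (\<bar>K\<bar> + 1)\<close>, which then bounds \<open>P\<close> from
    below.\<close>
  define \<kappa> where "\<kappa> = \<eta> * exp (- (C * (F b - a))) / (\<bar>K\<bar> + 1)"
  have "\<kappa> > 0"
    using \<open>\<eta> > 0\<close> by (auto simp: \<kappa>_def)
  have "isCont (\<lambda>t. F t - t) a"
    using \<open>isCont F a\<close> by (intro continuous_intros)
  then have "\<exists>e>0. \<forall>t. \<bar>t - a\<bar> < e \<longrightarrow> \<bar>F t - t\<bar> < \<kappa>"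
    using \<open>\<kappa> > 0\<close> fixa unfolding continuous_at_eps_delta dist_real_def by simp
  then obtain \<delta>0 where \<delta>0: "\<delta>0 > 0" "\<And>t. \<bar>t - a\<bar> < \<delta>0 \<Longrightarrow> \<bar>F t - t\<bar> < \<kappa>"
    by auto
  \<comment> \<open>The bound \<open>b - a\<close> starts the orbit below the fundamental domain,
    and \<open>\<delta>0\<close> keeps its first step shorter than \<open>\<kappa>\<close>.\<close>
  have "\<exists>k. K \<le> (\<Prod>j<k. c ((F ^^ j) t))" if t: "a < t" "t < a + min \<delta>0 (b - a)" for t
  proof -
    define z where "z j = (F ^^ j) t" for j
    have z_Suc: "z (Suc j) = F (z j)" for j
      by (simp add: z_def)
    have z0: "z 0 = t"
      by (simp add: z_def)
    have gt: "a < z j" for j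
      by (induction j) (use t fixa mono[of a] in \<open>auto simp: z0 z_Suc\<close>)
    \<comment> \<open>An orbit confined below \<open>b\<close> would increase to a fixed point of
      \<open>F\<close> in \<open>(a, b]\<close>, against \<open>rep\<close>.\<close>
    have "\<exists>k. b \<le> z k"
    proof (rule ccontr)
      assume "\<nexists>k. b \<le> z k"
      then have lt: "z k < b" for k
        by (simp add: not_le)
      have "incseq z"
        using rep gt lt b by (intro incseq_SucI) (metis z_Suc less_imp_le less_trans)
      moreover have "bdd_above (range z)"
        using lt by (meson bdd_aboveI2 less_imp_le)
      ultimately have lim: "z \<longlonglongrightarrow> (SUP k. z k)" (is "_ \<longlonglongrightarrow> ?L")
        by (rule LIMSEQ_incseq_SUP[rotated])
      have "t \<le> ?L"
        using \<open>bdd_above (range z)\<close> by (metis z0 cSUP_upper UNIV_I)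
      moreover have "?L \<le> b"
        using lt by (intro cSUP_least) (auto intro: less_imp_le)
      moreover have "(\<lambda>k. F (z k)) \<longlonglongrightarrow> F ?L"
        using lim F by (intro isCont_tendsto_compose[of _ F]) (auto intro: DERIV_isCont)
      then have "F ?L = ?L"
        using LIMSEQ_Suc[OF lim] LIMSEQ_unique by (auto simp: z_Suc)
      ultimately show False
        using rep[of ?L] t b by auto
    qed
    \<comment> \<open>For the first such index all earlier iterates lie below \<open>b\<close>.
      Hence the orbit up to \<open>k\<close> stays in \<open>[a, F b]\<close>, where the distortion
      bound holds, and \<open>z k\<close> lies in \<open>[b, F b]\<close>.\<close>
    define k where "k = (LEAST k. b \<le> z k)"
    have bk: "b \<le> z k"
      unfolding k_def using \<open>\<exists>k. b \<le> z k\<close> by (rule LeastI_ex)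
    have lt: "z j < b" if "j < k" for j
      using not_less_Least that unfolding k_def by (metis not_le)
    have le: "z j \<le> F b" if "j \<le> k" for j
    proof (cases j)
      case 0
      then show ?thesis using t b by (auto simp: z0)
    next
      case (Suc i)
      then have "z i < b" using that lt by auto
      then show ?thesis using mono Suc by (auto simp: z_Suc intro: less_imp_le)
    qed
    \<comment> \<open>The lengths of the intervals \<open>[z i, z (i + 1)]\<close>, \<open>i < j\<close>, telescope to \<open>z j - t\<close>, so the
      total distortion along the orbit stays bounded.\<close>
    have gap: "z (Suc j) - z j \<le> (\<Prod>i<j. c (z i)) * exp (C * (z j - t)) * (F t - t)"
      if "j \<le> k" for j
      using that
    proof (induction j)
      case 0
      then show ?case by (simp add: z0 z_Suc)
    next
      case (Suc j)
      have inc: "z j < z (Suc j)"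
        using rep[of "z j"] gt lt[of j] Suc b by (auto simp: z_Suc)
      then obtain \<xi> where \<xi>: "z j < \<xi>" "\<xi> < z (Suc j)"
          "z (Suc (Suc j)) - z (Suc j) = (z (Suc j) - z j) * c \<xi>"
        using MVT2[OF inc, of F c] F by (auto simp: z_Suc)
      have "c \<xi> \<le> c (z j) * exp (C * (\<xi> - z j))"
        using distortion \<xi> gt[of j] le[of "Suc j"] Suc.prems by auto
      also have "\<dots> \<le> c (z j) * exp (C * (z (Suc j) - z j))"
        using \<xi> pos[of "z j"] \<open>C \<ge> 0\<close> by (intro mult_left_mono) (auto intro: mult_left_mono)
      finally have "z (Suc (Suc j)) - z (Suc j) \<le>
          (z (Suc j) - z j) * (c (z j) * exp (C * (z (Suc j) - z j)))"
        using inc \<xi>(3) by (auto intro: mult_left_mono)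
      also have "\<dots> \<le> (\<Prod>i<j. c (z i)) * exp (C * (z j - t)) * (F t - t) *
          (c (z j) * exp (C * (z (Suc j) - z j)))"
        using Suc pos[of "z j"] by (intro mult_right_mono) (auto intro: less_imp_le)
      also have "\<dots> = (\<Prod>i<Suc j. c (z i)) * (exp (C * (z j - t)) * exp (C * (z (Suc j) - z j))) * (F t - t)"
        by simp
      also have "exp (C * (z j - t)) * exp (C * (z (Suc j) - z j)) = exp (C * (z (Suc j) - t))"
        by (simp add: exp_add[symmetric] algebra_simps)
      finally show ?case .
    qed
    define P where "P = (\<Prod>i<k. c (z i))"
    have "P > 0"
      unfolding P_def using pos by (intro prod_pos) auto
    have Ft: "0 \<le> F t - t" "F t - t < \<kappa>"
      using \<delta>0(2)[of t] rep[of t] t b by linarith+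
    \<comment> \<open>The step from the fundamental domain is compared with the first step of the
      orbit.\<close>
    have "\<eta> \<le> z (Suc k) - z k"
      using u(2)[of "z k"] bk le[of k] by (auto simp: \<eta>_def z_Suc)
    also have "\<dots> \<le> P * exp (C * (z k - t)) * (F t - t)"
      using gap[of k] by (simp add: P_def)
    also have "\<dots> \<le> P * exp (C * (F b - a)) * \<kappa>"
      using \<open>P > 0\<close> \<open>C \<ge> 0\<close> Ft t le[of k] by (intro mult_mono) (auto intro!: mult_left_mono)
    also have "\<dots> = P * \<eta> / (\<bar>K\<bar> + 1)"
      by (simp add: \<kappa>_def exp_minus)
    finally have "\<eta> * (\<bar>K\<bar> + 1) \<le> \<eta> * P"
      by (simp add: field_simps)
    then have "\<bar>K\<bar> + 1 \<le> P"
      using \<open>\<eta> > 0\<close> by (rule mult_left_le_imp_le)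
    then show ?thesis
      by (intro exI[of _ k]) (auto simp: P_def z_def)
  qed
  then show ?thesis
    using \<delta>0(1) b by (intro exI[of _ "min \<delta>0 (b - a)"]) auto
qed

text \<open>The affine map taking \<open>t\<close> to \<open>a + \<sigma> * t\<close> carries the
  right side of \<open>0\<close> to side \<open>\<sigma>\<close> of \<open>a\<close>. As
  \<open>\<sigma> * \<sigma> = 1\<close>, conjugating by it leaves the derivative at corresponding
  points unchanged, so the right-hand case applies.\<close>

lemma repelling_side:
  fixes F c d :: "real \<Rightarrow> real" and \<sigma> :: real
  assumes F: "\<And>t. (F has_real_derivative c t) (at t)"
    and c: "\<And>t. (c has_real_derivative d t) (at t)"
    and d: "continuous_on UNIV d"
    and pos: "\<And>t. 0 < c t"
    and fixa: "F a = a" and "0 < \<epsilon>" and \<sigma>: "\<sigma> * \<sigma> = 1"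
    and rep: "\<And>t. 0 < t \<Longrightarrow> t < \<epsilon> \<Longrightarrow> t < \<sigma> * (F (a + \<sigma> * t) - a)"
  shows "\<exists>\<delta>>0. \<forall>t. 0 < t \<and> t < \<delta> \<longrightarrow> (\<exists>k. K \<le> (\<Prod>j<k. c ((F ^^ j) (a + \<sigma> * t))))"
proof -
  define R where "R t = \<sigma> * (F (a + \<sigma> * t) - a)" for t
  have iter: "a + \<sigma> * (R ^^ j) t = (F ^^ j) (a + \<sigma> * t)" for j t
  proof (induction j)
    case (Suc j)
    have "a + \<sigma> * (R ^^ Suc j) t = a + (\<sigma> * \<sigma>) * (F (a + \<sigma> * (R ^^ j) t) - a)"
      by (simp add: R_def)
    with Suc show ?case by (simp add: \<sigma>)
  qed simp
  have aff: "((\<lambda>t. a + \<sigma> * t) has_real_derivative \<sigma>) (at t)" for t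
    by (auto intro!: derivative_eq_intros)
  have "\<exists>\<delta>>0. \<forall>t. 0 < t \<and> t < 0 + \<delta> \<longrightarrow>
      (\<exists>k. K \<le> (\<Prod>j<k. c (a + \<sigma> * (R ^^ j) t)))"
  proof (rule repelling_right[where d = "\<lambda>t. d (a + \<sigma> * t) * \<sigma>" and \<epsilon> = \<epsilon>])
    have "(R has_real_derivative \<sigma> * (c (a + \<sigma> * t) * \<sigma> - 0)) (at t)" for t
      unfolding R_def by (intro DERIV_cmult DERIV_diff DERIV_chain2[OF F aff] DERIV_const)
    moreover have "\<sigma> * (c (a + \<sigma> * t) * \<sigma> - 0) = c (a + \<sigma> * t)" for t
      using \<sigma> by (simp add: mult.left_commute[of \<sigma>])
    ultimately show "(R has_real_derivative c (a + \<sigma> * t)) (at t)" for t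
      by metis
    show "((\<lambda>t. c (a + \<sigma> * t)) has_real_derivative d (a + \<sigma> * t) * \<sigma>) (at t)" for t
      by (rule DERIV_chain2[OF c aff])
    show "continuous_on UNIV (\<lambda>t. d (a + \<sigma> * t) * \<sigma>)"
      by (intro continuous_intros continuous_on_compose2[OF d]) auto
    show "t < R t" if "0 < t" "t < 0 + \<epsilon>" for t
      using rep that by (auto simp: R_def)
  qed (use pos fixa \<open>0 < \<epsilon>\<close> in \<open>auto simp: R_def\<close>)
  then show ?thesis
    by (simp add: iter)
qed

section \<open>Lifts of circle diffeomorphisms to the angle coordinate\<close>

text \<open>A lift along \<open>cis\<close> together with its first two derivatives as explicit
  functions, which is the data that \<open>repelling_side\<close> consumes.\<close>

definition C2_lift ::
    "(complex \<Rightarrow> complex) \<Rightarrow> (real \<Rightarrow> real) \<Rightarrow> (real \<Rightarrow> real) \<Rightarrow> (real \<Rightarrow> real) \<Rightarrow> bool"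
  where "C2_lift f F c d \<longleftrightarrow>
    (\<forall>t. f (cis t) = cis (F t) \<and> (F has_real_derivative c t) (at t) \<and>
      (c has_real_derivative d t) (at t) \<and> 0 < c t) \<and>
    continuous_on UNIV d"

lemma C2_liftD:
  assumes "C2_lift f F c d"
  shows "f (cis t) = cis (F t)" "(F has_real_derivative c t) (at t)"
    "(c has_real_derivative d t) (at t)" "0 < c t" "continuous_on UNIV d"
  using assms by (auto simp: C2_lift_def)

lemma C2_lift_strict_mono:
  assumes "C2_lift f F c d" "s < t"
  shows "F s < F t"
  using assms(2) by (rule DERIV_pos_imp_increasing) (use C2_liftD(2,4)[OF assms(1)] in blast)

lemma circle_cisE:
  assumes "x \<in> circle"
  obtains t where "x = cis t" "- pi < t" "t \<le> pi"
proof (rule that)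
  show "x = cis (Arg x)"
    using assms cis_Arg[of x] by (cases "x = 0") (auto simp: sgn_div_norm)
qed (use Arg_bounded[of x] in auto)

lemma has_vector_derivative_cis_comp:
  assumes "(F has_real_derivative c) (at t)"
  shows "((\<lambda>t. cis (F t)) has_vector_derivative c *\<^sub>R (\<i> * cis (F t))) (at t)"
proof -
  have "(cis has_vector_derivative \<i> * cis u) (at u)" for u
  proof -
    have "((\<lambda>t. exp (\<i> * of_real t)) has_vector_derivative (\<i> * exp (\<i> * of_real u))) (at u)"
      by (rule has_vector_derivative_real_field) (auto intro!: derivative_eq_intros)
    then show ?thesis
      by (simp add: cis_conv_exp[abs_def])
  qed
  then show ?thesis
    using vector_diff_chain_at[of F c t cis] assms
    by (simp add: o_def has_real_derivative_iff_has_vector_derivative)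
qed

lemma circle_velocity_cis:
  assumes "((\<lambda>t. f (cis t)) has_vector_derivative D) (at \<theta>)"
  shows "circle_velocity f (cis \<theta>) = D"
proof -
  have shift: "((+) \<theta> has_vector_derivative 1) (at 0)"
    unfolding has_real_derivative_iff_has_vector_derivative[symmetric]
    by (auto intro!: derivative_eq_intros)
  have "((\<lambda>t. f (cis (\<theta> + t))) has_vector_derivative D) (at 0)"
    using vector_diff_chain_at[of "\<lambda>t. \<theta> + t" 1 0 "\<lambda>t. f (cis t)" D] assms
      shift
    by (simp add: o_def)
  then show ?thesis
    by (simp add: circle_velocity_def cis_mult vector_derivative_at)
qed

lemma C2_lift_velocity:
  assumes "C2_lift f F c d"
  shows "circle_velocity f (cis t) = c t *\<^sub>R (\<i> * f (cis t))"
  using circle_velocity_cis[of f "c t *\<^sub>R (\<i> * cis (F t))" t]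
    has_vector_derivative_cis_comp[OF C2_liftD(2)[OF assms]]
  by (simp add: C2_liftD(1)[OF assms])

text \<open>The lift is found by integrating the speed instead of by covering theory: an
  antiderivative \<open>F\<close> of the speed with \<open>F a = b\<close> makes
  \<open>cis (F t)\<close> and \<open>f (cis t)\<close> start at the same point and turn at the same
  rate.\<close>

lemma C2_lift_exists:
  assumes "f \<in> C2_diffeos" and "f (cis a) = cis b"
  obtains F c d where "C2_lift f F c d" "F a = b"
proof -
  have f: "f (cis t) \<in> circle" for t
    using assms by (auto simp: C2_diffeos_def Bij_def bij_betw_def)
  obtain D D' where D: "\<And>t. ((\<lambda>t. f (cis t)) has_vector_derivative D t) (at t)"
    and D': "\<And>t. (D has_vector_derivative D' t) (at t)" and cont: "continuous_on UNIV D'"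
    using assms unfolding C2_diffeos_def circle_C2_def C1_differentiable_on_def by auto
  \<comment> \<open>The component of the velocity along the unit tangent at the image point;
    preservation of orientation makes it positive and the whole velocity. \<open>d\<close> is its
    derivative by the product rule.\<close>
  define c where "c t = (\<i> * f (cis t)) \<bullet> D t" for t
  define d where "d t = (\<i> * f (cis t)) \<bullet> D' t + (\<i> * D t) \<bullet> D t" for t
  have c: "0 < c t \<and> D t = c t *\<^sub>R (\<i> * f (cis t))" for t
  proof -
    have "orientation_preserving f" "cis t \<in> circle"
      using assms by (auto simp: C2_diffeos_def)
    then obtain k where "k > 0" "circle_velocity f (cis t) = k *\<^sub>R (\<i> * f (cis t))"
      unfolding orientation_preserving_def by blast
    then have k: "k > 0" "D t = k *\<^sub>R (\<i> * f (cis t))"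
      using circle_velocity_cis[OF D, of t] by auto
    then have "c t = k"
      using f[of t] by (simp add: c_def dot_square_norm norm_mult)
    with k show ?thesis by simp
  qed
  have contD: "continuous_on UNIV D" "continuous_on UNIV (\<lambda>t. f (cis t))"
    using D D' has_vector_derivative_continuous by (blast intro: continuous_at_imp_continuous_on)+
  have dc: "(c has_real_derivative d t) (at t)" for t
    unfolding c_def d_def has_real_derivative_iff_has_vector_derivative
    by (intro bounded_bilinear.has_vector_derivative[OF bounded_bilinear_inner]
        has_vector_derivative_mult_right D D')
  have "\<exists>F. \<forall>t. - \<infinity> < ereal t \<longrightarrow> ereal t < \<infinity> \<longrightarrow> (F has_vector_derivative c t) (at t)"
    by (rule einterval_antiderivative) (auto intro: DERIV_isCont[OF dc])
  then obtain F0 where F0: "\<And>t. (F0 has_real_derivative c t) (at t)"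
    by (auto simp: has_real_derivative_iff_has_vector_derivative)
  define F where "F t = F0 t - F0 a + b" for t
  have F: "(F has_real_derivative c t) (at t)" for t
    unfolding F_def by (rule derivative_eq_intros F0 | simp)+
  \<comment> \<open>The quotient of the two curves has derivative zero, so it keeps its value at
    \<open>a\<close>, which is 1.\<close>
  have "((\<lambda>t. f (cis t) * cis (- F t)) has_vector_derivative 0) (at t)" for t
    using has_vector_derivative_mult[OF D[of t] has_vector_derivative_cis_comp[OF DERIV_minus[OF F[of t]]]] c[of t]
    by (simp add: algebra_simps scaleR_conv_of_real)
  then have const: "f (cis t) * cis (- F t) = f (cis a) * cis (- F a)" for t
    using has_vector_derivative_zero_constant[of UNIV "\<lambda>t. f (cis t) * cis (- F t)"] by fastforce
  have "f (cis t) = cis (F t)" for t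
  proof -
    have "f (cis t) * cis (- F t) = 1"
      using const[of t] assms by (simp add: F_def cis_mult)
    then have "f (cis t) * (cis (- F t) * cis (F t)) = cis (F t)"
      by (metis mult.assoc mult_1)
    then show ?thesis by (simp add: cis_mult)
  qed
  moreover have "continuous_on UNIV d"
    unfolding d_def by (intro continuous_intros cont contD)
  ultimately have "C2_lift f F c d"
    using F dc c by (auto simp: C2_lift_def)
  then show ?thesis
    by (rule that) (simp add: F_def)
qed

section \<open>Euclidean derivative and the chain rule\<close>

text \<open>As \<open>\<i> * x\<close> has Euclidean length one, this is the derivative in the
  standard metric, the reference against which every other metric is compared.\<close>

definition speed :: "(complex \<Rightarrow> complex) \<Rightarrow> complex \<Rightarrow> real"
  where "speed f x = norm (circle_velocity f x)"

lemma C2_lift_speed: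
  assumes "C2_lift f F c d"
  shows "speed f (cis t) = c t"
  using C2_liftD(4)[OF assms, of t] by (simp add: speed_def C2_lift_velocity[OF assms]
      C2_liftD(1)[OF assms] norm_mult)

lemma C2_diffeos_mem_circle: "f \<in> C2_diffeos \<Longrightarrow> x \<in> circle \<Longrightarrow> f x \<in> circle"
  by (auto simp: C2_diffeos_def Bij_def bij_betw_def)

lemma C2_lift_at:
  assumes "f \<in> C2_diffeos" "x \<in> circle"
  obtains F c d t where "C2_lift f F c d" "x = cis t" "f x = cis (F t)"
proof -
  obtain t where t: "x = cis t"
    using assms(2) by (rule circle_cisE)
  obtain b where "f x = cis b"
    using C2_diffeos_mem_circle[OF assms] by (rule circle_cisE)
  then obtain F c d where "C2_lift f F c d" "F t = b"
    using C2_lift_exists assms(1) t by metis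
  with t \<open>f x = cis b\<close> show ?thesis
    using that by blast
qed

lemma speed_pos:
  assumes "f \<in> C2_diffeos" "x \<in> circle"
  shows "0 < speed f x"
proof -
  obtain F c d t where "C2_lift f F c d" "x = cis t"
    using C2_lift_at[OF assms] .
  then show ?thesis
    using C2_liftD(4) by (simp add: C2_lift_speed)
qed

lemma velocity_C2_diffeos:
  assumes "f \<in> C2_diffeos" "x \<in> circle"
  shows "circle_velocity f x = speed f x *\<^sub>R (\<i> * f x)"
proof -
  obtain F c d t where "C2_lift f F c d" "x = cis t"
    using C2_lift_at[OF assms] .
  then show ?thesis
    by (simp add: C2_lift_speed C2_lift_velocity)
qed

text \<open>The composite of the lifts represents the composite map, so this is the chain rule on
  the real line.\<close>

lemma speed_compose:
  assumes f: "f \<in> C2_diffeos" and g: "g \<in> C2_diffeos" and "x \<in> circle"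
  shows "speed (compose circle f g) x = speed f (g x) * speed g x"
proof -
  obtain H b e t where H: "C2_lift g H b e" and x: "x = cis t" and gx: "g x = cis (H t)"
    using C2_lift_at[OF g \<open>x \<in> circle\<close>] .
  have "cis (H t) \<in> circle"
    by simp
  then obtain r where "f (cis (H t)) = cis r"
    using C2_diffeos_mem_circle[OF f] circle_cisE by blast
  then obtain F c d where F: "C2_lift f F c d"
    using C2_lift_exists[OF f] by blast
  have "((\<lambda>u. F (H u)) has_real_derivative c (H t) * b t) (at t)"
    using DERIV_chain2[OF C2_liftD(2)[OF F] C2_liftD(2)[OF H]] .
  then have "((\<lambda>u. cis (F (H u))) has_vector_derivative
      (c (H t) * b t) *\<^sub>R (\<i> * cis (F (H t)))) (at t)"
    by (rule has_vector_derivative_cis_comp)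
  then have "((\<lambda>u. compose circle f g (cis u)) has_vector_derivative
      (c (H t) * b t) *\<^sub>R (\<i> * cis (F (H t)))) (at t)"
    by (simp add: compose_def C2_liftD(1)[OF F] C2_liftD(1)[OF H])
  from circle_velocity_cis[OF this] have "speed (compose circle f g) (cis t) = c (H t) * b t"
    using C2_liftD(4)[OF F] C2_liftD(4)[OF H]
    by (simp add: speed_def norm_mult abs_mult less_imp_le)
  then show ?thesis
    using C2_lift_speed[OF F] C2_lift_speed[OF H] by (simp add: x gx[unfolded x])
qed

section \<open>Comparing Riemannian metrics with the Euclidean one\<close>

lemma riemannian_metric_scale:
  assumes "riemannian_metric h" "x \<in> circle"
  shows "h x (a *\<^sub>R (\<i> * x)) (a *\<^sub>R (\<i> * x)) = a\<^sup>2 * h x (\<i> * x) (\<i> * x)"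
proof -
  let ?T = "circle_tangent_space x"
  have T: "a *\<^sub>R (\<i> * x) \<in> ?T" for a
    by (simp add: circle_tangent_space_def inner_complex_def)
  have lin: "h x (a *\<^sub>R u) w = a * h x u w" if "u \<in> ?T" "w \<in> ?T" for u w a
  proof -
    have "h x (a *\<^sub>R u + 0 *\<^sub>R u) w = a * h x u w + 0 * h x u w"
      using assms that unfolding riemannian_metric_def by blast
    then show ?thesis by simp
  qed
  have sym: "h x u v = h x v u" if "u \<in> ?T" "v \<in> ?T" for u v
    using assms that unfolding riemannian_metric_def by blast
  have "h x (a *\<^sub>R (\<i> * x)) (a *\<^sub>R (\<i> * x)) = a * h x (\<i> * x) (a *\<^sub>R (\<i> * x))"
    using lin T[of 1] T by simp
  also have "\<dots> = a * (a * h x (\<i> * x) (\<i> * x))"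
    using sym[of "\<i> * x" "a *\<^sub>R (\<i> * x)"] lin T[of 1] T[of a] by simp
  finally show ?thesis by (simp add: power2_eq_square)
qed

text \<open>The factor by which \<open>h\<close>-length differs from Euclidean length. Tangent
  spaces being lines, this one function determines the metric.\<close>

definition metric_density :: "(complex \<Rightarrow> complex \<Rightarrow> complex \<Rightarrow> real) \<Rightarrow> complex \<Rightarrow> real"
  where "metric_density h x = sqrt (h x (\<i> * x) (\<i> * x))"

lemma metric_density_pos:
  assumes "riemannian_metric h" "x \<in> circle"
  shows "0 < metric_density h x"
proof -
  have "\<i> * x \<in> circle_tangent_space x" "\<i> * x \<noteq> 0"
    using assms by (auto simp: circle_tangent_space_def inner_complex_def)
  then show ?thesis
    using assms unfolding riemannian_metric_def metric_density_def by (simp add: Ball_def)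
qed

lemma continuous_metric_density:
  assumes "riemannian_metric h"
  shows "continuous_on UNIV (\<lambda>t. metric_density h (cis t))"
proof -
  \<comment> \<open>Order zero of the smoothness condition is differentiability of the coefficient
    itself.\<close>
  have "(\<lambda>t. h (cis t) (\<i> * cis t) (\<i> * cis t)) field_differentiable (at t)" for t
    using assms unfolding riemannian_metric_def smooth_real_def by (auto dest: spec[of _ 0])
  then have "continuous_on UNIV (\<lambda>t. h (cis t) (\<i> * cis t) (\<i> * cis t))"
    by (intro continuous_at_imp_continuous_on ballI field_differentiable_imp_continuous_at)
  then show ?thesis
    unfolding metric_density_def by (intro continuous_intros)
qed

text \<open>Compactness of one period of the angle. These uniform bounds make any two metrics
  comparable.\<close>

lemma metric_density_bounds:
  assumes "riemannian_metric h"
  obtains m M where "0 < m" "\<And>x. x \<in> circle \<Longrightarrow> m \<le> metric_density h x"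
    "\<And>x. x \<in> circle \<Longrightarrow> metric_density h x \<le> M"
proof -
  let ?I = "{- pi..pi}"
  let ?f = "\<lambda>t. metric_density h (cis t)"
  have cont: "continuous_on ?I ?f"
    using continuous_metric_density[OF assms] continuous_on_subset by blast
  obtain u where u: "\<And>t. t \<in> ?I \<Longrightarrow> ?f u \<le> ?f t"
    using continuous_attains_inf[OF compact_Icc _ cont] by (auto simp del: atLeastAtMost_iff)
  obtain v where v: "\<And>t. t \<in> ?I \<Longrightarrow> ?f t \<le> ?f v"
    using continuous_attains_sup[OF compact_Icc _ cont] by (auto simp del: atLeastAtMost_iff)
  show ?thesis
  proof (rule that)
    show "0 < ?f u"
      using metric_density_pos[OF assms] by simp
    show "?f u \<le> metric_density h x" "metric_density h x \<le> ?f v" if xc: "x \<in> circle" for x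
    proof -
      obtain t where "x = cis t" "- pi < t" "t \<le> pi"
        using xc by (rule circle_cisE)
      then show "?f u \<le> metric_density h x" "metric_density h x \<le> ?f v"
        using u[of t] v[of t] by auto
    qed
  qed
qed

text \<open>The metric enters only through a ratio of densities, which telescopes under composition
  and stays bounded over all of the circle.\<close>

lemma metric_deriv_eq:
  assumes "riemannian_metric h" "f \<in> C2_diffeos" "x \<in> circle"
  shows "metric_deriv h f x = speed f x * metric_density h (f x) / metric_density h x"
  using riemannian_metric_scale[OF assms(1) C2_diffeos_mem_circle[OF assms(2,3)], of "speed f x"]
    speed_pos[OF assms(2,3)] velocity_C2_diffeos[OF assms(2,3)]
  by (simp add: metric_deriv_def metric_density_def real_sqrt_mult)

lemma metric_deriv_pos:
  assumes "riemannian_metric h" "f \<in> C2_diffeos" "x \<in> circle"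
  shows "0 < metric_deriv h f x"
  using assms metric_density_pos C2_diffeos_mem_circle speed_pos by (simp add: metric_deriv_eq)

lemma metric_deriv_compose:
  assumes "riemannian_metric h" "f \<in> C2_diffeos" "g \<in> C2_diffeos"
    "compose circle f g \<in> C2_diffeos" "x \<in> circle"
  shows "metric_deriv h (compose circle f g) x = metric_deriv h f (g x) * metric_deriv h g x"
proof -
  have gx: "g x \<in> circle"
    by (rule C2_diffeos_mem_circle[OF assms(3,5)])
  have "metric_density h (g x) > 0"
    using metric_density_pos[OF assms(1) gx] .
  then show ?thesis
    unfolding metric_deriv_eq[OF assms(1,4,5)] metric_deriv_eq[OF assms(1,2) gx]
      metric_deriv_eq[OF assms(1,3,5)] speed_compose[OF assms(2,3,5)] compose_eq[OF assms(5)]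
    by simp
qed

lemma isCont_metric_deriv_cis:
  assumes "riemannian_metric h" "f \<in> C2_diffeos"
  shows "isCont (\<lambda>t. metric_deriv h f (cis t)) a"
proof -
  have "cis a \<in> circle"
    by simp
  then obtain F c d where F: "C2_lift f F c d"
    using C2_lift_at[OF assms(2)] by blast
  have eq: "metric_deriv h f (cis t) =
      c t * metric_density h (cis (F t)) / metric_density h (cis t)" for t
    using assms by (simp add: metric_deriv_eq C2_lift_speed[OF F] C2_liftD(1)[OF F])
  have dens: "isCont (\<lambda>t. metric_density h (cis t)) u" for u
    using continuous_metric_density[OF assms(1)] by (simp add: continuous_on_eq_continuous_at)
  show ?thesis
    unfolding eq
    using metric_density_pos[OF assms(1), of "cis a"] C2_liftD(2,3)[OF F, of a]
    by (intro continuous_intros isCont_o2[OF _ dens] dens) (auto intro: DERIV_isCont simp: less_imp_neq[THEN not_sym])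
qed

section \<open>One-sided isolation of fixed points\<close>

lemma cis_inj_near:
  assumes "cis s = cis t" "\<bar>s - t\<bar> < 2 * pi"
  shows "s = t"
proof -
  have "cis (s - t) = 1"
    using assms(1) by (simp add: cis_divide[symmetric])
  then have "cos (s - t) = 1"
    by (simp add: complex_eq_iff)
  then obtain n :: int where n: "s - t = of_int n * 2 * pi"
    using cos_one_2pi_int by auto
  with assms(2) have "\<bar>of_int n :: real\<bar> < 1"
    by (simp add: abs_mult)
  then have "n = 0"
    by linarith
  with n show ?thesis by simp
qed

text \<open>\<open>\<sigma>\<close> is 1 for the positive side and -1 for the negative one, while
  \<open>t\<close> stays positive. One argument then treats both sides, each with its own
  radius.\<close>

definition isolating :: "real \<Rightarrow> (complex \<Rightarrow> complex) \<Rightarrow> complex \<Rightarrow> bool"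
  where "isolating \<sigma> f y \<longleftrightarrow> f y = y \<and>
    (\<exists>\<epsilon>>0. \<forall>t. 0 < t \<and> t < \<epsilon> \<longrightarrow> f (y * cis (\<sigma> * t)) \<noteq> y * cis (\<sigma> * t))"

text \<open>Only the common radius couples the two sides, and the smaller of two radii serves
  both.\<close>

lemma property_star_iff:
  "property_star h G \<Lambda> \<longleftrightarrow>
    (\<forall>x \<in> \<Lambda> \<inter> NE h G. (\<exists>f\<in>G. isolating 1 f x) \<and> (\<exists>f\<in>G. isolating (- 1) f x))"
proof -
  have "(\<exists>gp\<in>G. \<exists>gm\<in>G. gp x = x \<and> gm x = x \<and>
       (\<exists>\<epsilon>>0. (\<forall>t\<in>{0<..<\<epsilon>}. gp (x * cis t) \<noteq> x * cis t) \<and>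
              (\<forall>t\<in>{-\<epsilon><..<0}. gm (x * cis t) \<noteq> x * cis t))) \<longleftrightarrow>
    (\<exists>f\<in>G. isolating 1 f x) \<and> (\<exists>f\<in>G. isolating (- 1) f x)" (is "?L \<longleftrightarrow> ?R") for x
  proof
    assume ?L
    then obtain gp gm \<epsilon> where g: "gp \<in> G" "gm \<in> G" "gp x = x" "gm x = x" "\<epsilon> > 0"
      and p: "\<And>t. t \<in> {0<..<\<epsilon>} \<Longrightarrow> gp (x * cis t) \<noteq> x * cis t"
      and m: "\<And>t. t \<in> {-\<epsilon><..<0} \<Longrightarrow> gm (x * cis t) \<noteq> x * cis t"
      by blast
    have "isolating 1 gp x"
      using g p by (auto simp: isolating_def)
    moreover have "gm (x * cis (- t)) \<noteq> x * cis (- t)" if "0 < t" "t < \<epsilon>" for t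
      using m[of "- t"] that by auto
    then have "isolating (- 1) gm x"
      using g by (auto simp: isolating_def)
    ultimately show ?R
      using g by blast
  next
    assume ?R
    then obtain gp gm where g: "gp \<in> G" "gm \<in> G" "isolating 1 gp x" "isolating (- 1) gm x"
      by blast
    then obtain \<epsilon>p \<epsilon>m where \<epsilon>: "\<epsilon>p > 0" "\<epsilon>m > 0"
      and p: "\<And>t. 0 < t \<Longrightarrow> t < \<epsilon>p \<Longrightarrow> gp (x * cis (1 * t)) \<noteq> x * cis (1 * t)"
      and m: "\<And>t. 0 < t \<Longrightarrow> t < \<epsilon>m \<Longrightarrow> gm (x * cis (- 1 * t)) \<noteq> x * cis (- 1 * t)"
      unfolding isolating_def by metis
    have "gm (x * cis t) \<noteq> x * cis t" if "t \<in> {- min \<epsilon>p \<epsilon>m<..<0}" for t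
      using m[of "- t"] that by (auto simp: min_def split: if_splits)
    moreover have "gp (x * cis t) \<noteq> x * cis t" if "t \<in> {0<..<min \<epsilon>p \<epsilon>m}" for t
      using p[of t] that by auto
    moreover have "min \<epsilon>p \<epsilon>m > 0"
      using \<epsilon> by simp
    ultimately show ?L
      using g unfolding isolating_def by blast
  qed
  then show ?thesis
    by (simp add: property_star_def)
qed

lemma continuous_nonzero_sign:
  fixes \<phi> :: "real \<Rightarrow> real"
  assumes "continuous_on {a<..<b} \<phi>" and nz: "\<And>t. t \<in> {a<..<b} \<Longrightarrow> \<phi> t \<noteq> 0"
  shows "(\<forall>t\<in>{a<..<b}. 0 < \<phi> t) \<or> (\<forall>t\<in>{a<..<b}. \<phi> t < 0)"
proof (rule ccontr)
  assume "\<not> ?thesis"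
  then obtain s t where st: "s \<in> {a<..<b}" "\<phi> s < 0" "t \<in> {a<..<b}" "0 < \<phi> t"
    using nz by (metis linorder_neqE_linordered_idom)
  have "connected (\<phi> ` {a<..<b})"
    using assms(1) by (rule connected_continuous_image) simp
  then have "0 \<in> \<phi> ` {a<..<b}"
    using connectedD_interval[of "\<phi> ` {a<..<b}" "\<phi> s" "\<phi> t" 0] st by auto
  with nz show False by auto
qed

section \<open>Large derivatives near an isolated fixed point\<close>

locale C2_circle_group =
  fixes G :: "(complex \<Rightarrow> complex) set"
  assumes subgroup: "subgroup G (BijGroup circle)" and C2: "G \<subseteq> C2_diffeos"
begin

lemma in_C2: "f \<in> G \<Longrightarrow> f \<in> C2_diffeos"
  using C2 by blast

lemma mem_circle: "f \<in> G \<Longrightarrow> x \<in> circle \<Longrightarrow> f x \<in> circle"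
  using in_C2 C2_diffeos_mem_circle by blast

lemma in_Bij: "f \<in> G \<Longrightarrow> f \<in> Bij circle"
  using in_C2 by (auto simp: C2_diffeos_def)

lemma identity_mem: "(\<lambda>x\<in>circle. x) \<in> G"
  using subgroup.one_closed[OF subgroup] by (simp add: BijGroup_def)

lemma compose_mem:
  assumes "f \<in> G" "g \<in> G"
  shows "compose circle f g \<in> G"
  using subgroup.m_closed[OF subgroup assms] assms in_Bij by (simp add: BijGroup_def)

lemma inverse_exists:
  assumes "f \<in> G"
  shows "\<exists>q\<in>G. \<forall>x\<in>circle. q (f x) = x \<and> f (q x) = x"
proof (intro bexI ballI conjI)
  let ?q = "inv\<^bsub>BijGroup circle\<^esub> f"
  show q: "?q \<in> G"
    using subgroup.m_inv_closed[OF subgroup assms] .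
  have car: "f \<in> carrier (BijGroup circle)"
    using in_Bij[OF assms] by (simp add: BijGroup_def)
  have "compose circle ?q f = (\<lambda>x\<in>circle. x)" "compose circle f ?q = (\<lambda>x\<in>circle. x)"
    using group.l_inv[OF group_BijGroup car] group.r_inv[OF group_BijGroup car]
      in_Bij[OF assms] in_Bij[OF q] by (simp_all add: BijGroup_def)
  then show "?q (f x) = x" "f (?q x) = x" if "x \<in> circle" for x
    using that by (metis compose_eq restrict_apply')+
qed

text \<open>Realizes the derivative products of \<open>repelling_side\<close> as speeds of group
  elements.\<close>

lemma iterate_exists:
  assumes "f \<in> G" "C2_lift f F c d"
  shows "\<exists>q\<in>G. \<forall>t. q (cis t) = cis ((F ^^ k) t) \<and> speed q (cis t) = (\<Prod>j<k. c ((F ^^ j) t))"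
proof (induction k)
  case 0
  have "((\<lambda>t. (\<lambda>x\<in>circle. x) (cis t)) has_vector_derivative 1 *\<^sub>R (\<i> * cis t)) (at t)" for t
    using has_vector_derivative_cis_comp[OF DERIV_ident, of t] by simp
  from circle_velocity_cis[OF this] have "speed (\<lambda>x\<in>circle. x) (cis t) = 1" for t
    unfolding speed_def by (simp add: norm_mult del: restrict_apply)
  then show ?case
    by (intro bexI[OF _ identity_mem]) (simp del: restrict_apply, simp)
next
  case (Suc k)
  then obtain q where q: "q \<in> G" "\<And>t. q (cis t) = cis ((F ^^ k) t)"
      "\<And>t. speed q (cis t) = (\<Prod>j<k. c ((F ^^ j) t))"
    by blast
  have "speed (compose circle f q) (cis t) = (\<Prod>j<Suc k. c ((F ^^ j) t))" for t
    using speed_compose[OF in_C2[OF assms(1)] in_C2[OF q(1)], of "cis t"]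
    by (simp add: q C2_lift_speed[OF assms(2)])
  moreover have "compose circle f q (cis t) = cis ((F ^^ Suc k) t)" for t
    by (simp add: compose_def q C2_liftD(1)[OF assms(2)])
  ultimately show ?case
    using compose_mem[OF assms(1) q(1)] by blast
qed

lemma escape_repelling:
  assumes "f \<in> G" "C2_lift f F c d" "F a = a" "0 < \<epsilon>" "\<sigma> * \<sigma> = 1"
    and "\<And>t. 0 < t \<Longrightarrow> t < \<epsilon> \<Longrightarrow> t < \<sigma> * (F (a + \<sigma> * t) - a)"
  shows "\<exists>\<delta>>0. \<forall>t. 0 < t \<and> t < \<delta> \<longrightarrow> (\<exists>q\<in>G. K \<le> speed q (cis (a + \<sigma> * t)))"
proof -
  have "\<exists>\<delta>>0. \<forall>t. 0 < t \<and> t < \<delta> \<longrightarrow> (\<exists>k. K \<le> (\<Prod>j<k. c ((F ^^ j) (a + \<sigma> * t))))"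
    by (rule repelling_side[OF C2_liftD(2,3)[OF assms(2)] C2_liftD(5)[OF assms(2)]
          C2_liftD(4)[OF assms(2)] assms(3-6)])
  then show ?thesis
    using iterate_exists[OF assms(1,2)] by metis
qed

text \<open>Beside an isolated fixed point the displacement of the lift has constant sign. If
  \<open>f\<close> pushes points away, its iterates serve; if it attracts them, its inverse pushes
  away and the iterates of the inverse serve.\<close>

lemma escape:
  assumes f: "f \<in> G" and iso: "isolating \<sigma> f (cis a)" and \<sigma>: "\<sigma> = 1 \<or> \<sigma> = - 1"
  shows "\<exists>\<delta>>0. \<forall>t. 0 < t \<and> t < \<delta> \<longrightarrow> (\<exists>q\<in>G. K \<le> speed q (cis (a + \<sigma> * t)))"
proof -
  have \<sigma>2: "\<sigma> * \<sigma> = 1" "\<sigma> * (\<sigma> * u) = u" for u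
    using \<sigma> by auto
  have fa: "f (cis a) = cis a"
    using iso by (simp add: isolating_def)
  obtain \<epsilon>0 where "\<epsilon>0 > 0"
      "\<And>t. 0 < t \<Longrightarrow> t < \<epsilon>0 \<Longrightarrow> f (cis a * cis (\<sigma> * t)) \<noteq> cis a * cis (\<sigma> * t)"
    using iso unfolding isolating_def by blast
  \<comment> \<open>The cap \<open>2 * pi\<close> makes angles within this range comparable through
    \<open>cis_inj_near\<close>.\<close>
  then obtain \<epsilon> where \<epsilon>: "0 < \<epsilon>" "\<epsilon> \<le> 2 * pi"
      "\<And>t. 0 < t \<Longrightarrow> t < \<epsilon> \<Longrightarrow> f (cis (a + \<sigma> * t)) \<noteq> cis (a + \<sigma> * t)"
    using that[of "min \<epsilon>0 (2 * pi)"] by (auto simp: cis_mult)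
  obtain F c d where F: "C2_lift f F c d" "F a = a"
    using C2_lift_exists[OF in_C2[OF f] fa] .
  \<comment> \<open>\<open>F\<close> in the coordinate that measures signed distance from
    \<open>a\<close> towards side \<open>\<sigma>\<close>.\<close>
  define \<phi> where "\<phi> t = \<sigma> * (F (a + \<sigma> * t) - a)" for t
  have \<phi>: "F (a + \<sigma> * t) = a + \<sigma> * \<phi> t" for t
    by (simp add: \<phi>_def \<sigma>2)
  have contF: "continuous_on UNIV F"
    by (rule DERIV_continuous_on[OF C2_liftD(2)[OF F(1)]])
  have cont: "continuous_on S \<phi>" for S
    unfolding \<phi>_def by (intro continuous_intros continuous_on_compose2[OF contF]) auto
  have ne: "\<phi> t - t \<noteq> 0" if "t \<in> {0<..<\<epsilon>}" for t
    using \<epsilon>(3)[of t] that C2_liftD(1)[OF F(1), of "a + \<sigma> * t"] \<phi>[of t] by auto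
  consider "\<forall>t\<in>{0<..<\<epsilon>}. 0 < \<phi> t - t" | "\<forall>t\<in>{0<..<\<epsilon>}. \<phi> t - t < 0"
    using continuous_nonzero_sign[OF continuous_on_diff[OF cont continuous_on_id] ne] by blast
  then show ?thesis
  proof cases
    case 1
    then show ?thesis
      by (intro escape_repelling[OF f F \<open>0 < \<epsilon>\<close> \<sigma>2(1)]) (auto simp: \<phi>_def)
  next
    case 2
    obtain q where q: "q \<in> G" "\<And>x. x \<in> circle \<Longrightarrow> q (f x) = x" "\<And>x. x \<in> circle \<Longrightarrow> f (q x) = x"
      using inverse_exists[OF f] by blast
    have "q (cis a) = cis a"
      using q(2)[of "cis a"] fa by simp
    then obtain H b e where H: "C2_lift q H b e" "H a = a"
      using C2_lift_exists[OF in_C2[OF q(1)]] by metis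
    define \<psi> where "\<psi> t = \<sigma> * (H (a + \<sigma> * t) - a)" for t
    have \<psi>: "H (a + \<sigma> * t) = a + \<sigma> * \<psi> t" for t
      by (simp add: \<psi>_def \<sigma>2)
    have pos: "0 < \<phi> t" "0 < \<psi> t" if "0 < t" for t
      using \<sigma> that C2_lift_strict_mono[OF F(1), of a "a + t"] C2_lift_strict_mono[OF F(1), of "a - t" a]
        C2_lift_strict_mono[OF H(1), of a "a + t"] C2_lift_strict_mono[OF H(1), of "a - t" a]
      by (auto simp: \<phi>_def \<psi>_def F(2) H(2))
    \<comment> \<open>On the circle \<open>f\<close> undoes \<open>q\<close>, so
      \<open>\<phi> (\<psi> t)\<close> and \<open>t\<close> agree modulo \<open>2 * pi\<close>. If
      \<open>\<psi> t \<le> t\<close>, attraction puts \<open>\<phi> (\<psi> t)\<close> strictly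
      between \<open>0\<close> and \<open>t\<close>, too close to \<open>t\<close> for a different
      representative.\<close>
    have "t < \<psi> t" if t: "0 < t" "t < \<epsilon>" for t
    proof (rule ccontr)
      assume "\<not> t < \<psi> t"
      then have le: "\<psi> t \<le> t" by simp
      have less: "\<phi> (\<psi> t) < t"
        using bspec[OF 2, of "\<psi> t"] le pos(2)[OF t(1)] t by simp
      have "cis (a + \<sigma> * \<phi> (\<psi> t)) = cis (a + \<sigma> * t)"
        using q(3)[of "cis (a + \<sigma> * t)"] C2_liftD(1)[OF F(1)] C2_liftD(1)[OF H(1)]
        by (simp add: \<phi> \<psi>)
      moreover have "\<bar>(a + \<sigma> * \<phi> (\<psi> t)) - (a + \<sigma> * t)\<bar> < 2 * pi"
        using \<sigma> less t \<epsilon>(2) pos(1)[OF pos(2)[OF t(1)]] by auto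
      ultimately have "a + \<sigma> * \<phi> (\<psi> t) = a + \<sigma> * t"
        by (rule cis_inj_near)
      with less \<sigma> show False by auto
    qed
    then show ?thesis
      by (intro escape_repelling[OF q(1) H \<open>0 < \<epsilon>\<close> \<sigma>2(1)]) (auto simp: \<psi>_def)
  qed
qed

section \<open>Transport of isolation along an orbit\<close>

text \<open>Conjugation by \<open>g\<close> matches fixed points near \<open>x\<close> with fixed
  points near \<open>g x\<close>. The lift of \<open>g\<close> is increasing, so the side is
  preserved, and continuous, so a small radius at \<open>x\<close> lands within the given
  one.\<close>

lemma isolating_conjugate:
  assumes g: "g \<in> G" and x: "x \<in> circle" and f: "f \<in> G" and iso: "isolating \<sigma> f (g x)"
    and \<sigma>: "\<sigma> = 1 \<or> \<sigma> = - 1"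
  shows "\<exists>f'\<in>G. isolating \<sigma> f' x"
proof -
  obtain q where q: "q \<in> G" "\<And>x. x \<in> circle \<Longrightarrow> q (g x) = x" "\<And>x. x \<in> circle \<Longrightarrow> g (q x) = x"
    using inverse_exists[OF g] by blast
  define f' where "f' = compose circle q (compose circle f g)"
  have f': "f' \<in> G"
    unfolding f'_def by (intro compose_mem q f g)
  have gf': "g (f' z) = f (g z)" if "z \<in> circle" for z
    using q(3)[OF mem_circle[OF f mem_circle[OF g that]]] that by (simp add: f'_def compose_def)
  obtain F c d b where F: "C2_lift g F c d" and b: "x = cis b" "g x = cis (F b)"
    using C2_lift_at[OF in_C2[OF g] x] .
  obtain \<epsilon> where \<epsilon>: "\<epsilon> > 0"
      "\<And>t. 0 < t \<Longrightarrow> t < \<epsilon> \<Longrightarrow> f (g x * cis (\<sigma> * t)) \<noteq> g x * cis (\<sigma> * t)"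
    using iso unfolding isolating_def by blast
  have "isCont F b"
    by (rule DERIV_isCont[OF C2_liftD(2)[OF F]])
  then have "\<exists>\<delta>>0. \<forall>t. \<bar>t - b\<bar> < \<delta> \<longrightarrow> \<bar>F t - F b\<bar> < \<epsilon>"
    using \<epsilon>(1) unfolding continuous_at_eps_delta dist_real_def by simp
  then obtain \<delta> where \<delta>: "\<delta> > 0" "\<And>t. \<bar>t - b\<bar> < \<delta> \<Longrightarrow> \<bar>F t - F b\<bar> < \<epsilon>"
    by auto
  have "f' (x * cis (\<sigma> * t)) \<noteq> x * cis (\<sigma> * t)" if t: "0 < t" "t < \<delta>" for t
  proof
    assume fixed: "f' (x * cis (\<sigma> * t)) = x * cis (\<sigma> * t)"
    \<comment> \<open>The distance of the image point from \<open>g x\<close> in the lift, measured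
      towards side \<open>\<sigma>\<close>.\<close>
    define s where "s = \<sigma> * (F (b + \<sigma> * t) - F b)"
    have mono: "F b < F (b + t)" "F (b - t) < F b"
      using t by (auto intro: C2_lift_strict_mono[OF F])
    have near: "\<bar>F (b + \<sigma> * t) - F b\<bar> < \<epsilon>"
      using \<sigma> t by (intro \<delta>(2)) auto
    have "0 < s \<and> s < \<epsilon>"
      using \<sigma>
    proof
      assume "\<sigma> = 1"
      then show ?thesis
        using mono near by (simp add: s_def)
    next
      assume "\<sigma> = - 1"
      then show ?thesis
        using mono near by (simp add: s_def)
    qed
    then have s: "0 < s" "s < \<epsilon>"
      by auto
    have "g (x * cis (\<sigma> * t)) = g x * cis (\<sigma> * s)"
    proof -
      have "F (b + \<sigma> * t) = F b + \<sigma> * s"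
        using \<sigma> by (auto simp: s_def)
      then show ?thesis
        unfolding b(2) unfolding b(1) cis_mult C2_liftD(1)[OF F] by simp
    qed
    moreover have "x * cis (\<sigma> * t) \<in> circle"
      using b by (simp add: norm_mult)
    ultimately show False
      using \<epsilon>(2)[OF s] gf'[of "x * cis (\<sigma> * t)"] fixed by simp
  qed
  moreover have "f' x = x"
    using iso x q(2)[OF x] by (simp add: f'_def compose_def isolating_def)
  ultimately have "isolating \<sigma> f' x"
    using \<delta>(1) by (auto simp: isolating_def)
  with f' show ?thesis by blast
qed

section \<open>Orbits with bounded derivatives reach a non-expandable point\<close>

text \<open>The bound \<open>C\<close> concerns the Euclidean speed, so it can be supplied by a
  metric other than \<open>h\<close>. It makes the supremum of the \<open>h\<close>-derivatives at
  \<open>x\<close> finite and later contradicts escape from the limit point.\<close>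

lemma orbit_meets_NE:
  assumes h: "riemannian_metric h" and star: "property_star h G \<Lambda>"
    and \<Lambda>: "closed \<Lambda>" "\<Lambda> \<subseteq> circle" "\<And>g. g \<in> G \<Longrightarrow> g ` \<Lambda> = \<Lambda>" and x: "x \<in> \<Lambda>"
    and C: "\<And>g. g \<in> G \<Longrightarrow> speed g x \<le> C"
  shows "\<exists>g\<in>G. g x \<in> \<Lambda> \<inter> NE h G"
proof -
  have xc: "x \<in> circle"
    using x \<Lambda> by blast
  obtain m1 m2 where m: "0 < m1" "\<And>z. z \<in> circle \<Longrightarrow> m1 \<le> metric_density h z"
      "\<And>z. z \<in> circle \<Longrightarrow> metric_density h z \<le> m2"
    using metric_density_bounds[OF h] by metis
  have m2: "0 < m2"
    using m(1) m(2,3)[OF xc] by linarith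
  let ?D = "\<lambda>g. metric_deriv h g x"
  have D_le: "?D g \<le> speed g x * (m2 / m1)" if "g \<in> G" for g
  proof -
    have "metric_density h (g x) / metric_density h x \<le> m2 / m1"
      using m(1) m(2)[OF xc] m(3)[OF mem_circle[OF that xc]] m2 by (intro frac_le) auto
    then have "speed g x * (metric_density h (g x) / metric_density h x) \<le> speed g x * (m2 / m1)"
      using speed_pos[OF in_C2[OF that] xc] by (intro mult_left_mono) auto
    then show ?thesis
      by (simp add: metric_deriv_eq[OF h in_C2[OF that] xc])
  qed
  have bdd: "bdd_above (?D ` G)"
  proof (rule bdd_aboveI2)
    fix g assume g: "g \<in> G"
    have "speed g x * (m2 / m1) \<le> C * (m2 / m1)"
      using C[OF g] m(1) m2 by (intro mult_right_mono) auto
    then show "?D g \<le> C * (m2 / m1)"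
      using D_le[OF g] by linarith
  qed
  define M where "M = (SUP g\<in>G. ?D g)"
  have D_le_M: "?D g \<le> M" if "g \<in> G" for g
    unfolding M_def using bdd that by (rule cSUP_upper2[OF _ _ order_refl])
  have M: "0 < M"
    using metric_deriv_pos[OF h in_C2[OF identity_mem] xc] D_le_M[OF identity_mem] by linarith
  \<comment> \<open>The shift by 2 keeps the factor at least one half for every \<open>n\<close>,
    which yields the uniform bound \<open>half\<close>.\<close>
  have "\<exists>g\<in>G. M * (1 - 1 / (real n + 2)) < ?D g" for n
  proof -
    have "M * (1 - 1 / (real n + 2)) < M"
      using M by (simp add: field_simps)
    then show ?thesis
      unfolding M_def[symmetric] using less_cSUP_iff[OF _ bdd] identity_mem M_def by blast
  qed
  then obtain g where g: "\<And>n. g n \<in> G" "\<And>n. M * (1 - 1 / (real n + 2)) < ?D (g n)"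
    by metis
  have half: "M / 2 \<le> ?D (g n)" for n
  proof -
    have "1 / 2 \<le> 1 - 1 / (real n + 2)"
      by (simp add: field_simps)
    then have "M * (1 / 2) \<le> M * (1 - 1 / (real n + 2))"
      using M by (intro mult_left_mono) auto
    then show ?thesis
      using g(2)[of n] by linarith
  qed
  have lim_M: "(\<lambda>n. ?D (g n)) \<longlonglongrightarrow> M"
  proof (rule tendsto_sandwich[where h = "\<lambda>_. M"])
    have "(\<lambda>n. M * (1 - 1 / (real n + 2))) \<longlonglongrightarrow> M * (1 - 0)"
      using LIMSEQ_ignore_initial_segment[OF lim_1_over_n, of 2]
      by (intro tendsto_intros) (simp add: add.commute)
    then show "(\<lambda>n. M * (1 - 1 / (real n + 2))) \<longlonglongrightarrow> M"
      by simp
  qed (use g D_le_M in \<open>simp_all add: less_imp_le\<close>)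
  have "compact \<Lambda>"
    using \<Lambda>(1,2) by (meson bounded_subset bounded_sphere compact_eq_bounded_closed)
  moreover have orb: "g n x \<in> \<Lambda>" for n
    using \<Lambda>(3)[OF g(1)] x by blast
  ultimately obtain y r where y: "y \<in> \<Lambda>" "strict_mono r" and lim: "((\<lambda>n. g n x) \<circ> r) \<longlonglongrightarrow> y"
    unfolding compact_def by metis
  have yc: "y \<in> circle"
    using y \<Lambda> by blast
  obtain a where a: "y = cis a"
    using yc by (rule circle_cisE)
  \<comment> \<open>The signed angle from \<open>y\<close> to the orbit point. It tends to 0 because
    \<open>Arg\<close> is continuous at 1.\<close>
  define s where "s n = Arg (g (r n) x / y)" for n
  have y_s: "g (r n) x = cis (a + s n)" for n
  proof -
    have "cmod (g (r n) x / y) = 1"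
      using orb[of "r n"] \<Lambda>(2) yc by (auto simp: norm_divide)
    then have "cis (s n) = g (r n) x / y"
      unfolding s_def using cis_Arg[of "g (r n) x / y"] by (cases "g (r n) x / y = 0") (auto simp: sgn_div_norm)
    then show ?thesis
      using yc by (auto simp: cis_mult[symmetric] a[symmetric])
  qed
  have "(\<lambda>n. g (r n) x / y) \<longlonglongrightarrow> y / y"
    using lim yc by (intro tendsto_intros) (auto simp: o_def)
  moreover have "y / y = 1"
    using yc by auto
  moreover have "isCont Arg 1"
    by (rule continuous_at_Arg) (auto simp: complex_nonpos_Reals_iff)
  ultimately have lim_s: "s \<longlonglongrightarrow> 0"
    unfolding s_def using isCont_tendsto_compose[of 1 Arg] by fastforce
  \<comment> \<open>The composite of \<open>f\<close> with \<open>g (r n)\<close> has derivative at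
    most \<open>M\<close> at \<open>x\<close>; in the limit the chain rule gives
    \<open>metric_deriv h f y * M \<le> M\<close>.\<close>
  have "metric_deriv h f y \<le> 1" if f: "f \<in> G" for f
  proof -
    have "metric_deriv h f (cis (a + s n)) * ?D (g (r n)) \<le> M" for n
      using D_le_M[OF compose_mem[OF f g(1)]]
        metric_deriv_compose[OF h in_C2[OF f] in_C2[OF g(1)] in_C2[OF compose_mem[OF f g(1)]] xc]
      by (metis y_s)
    moreover have "(\<lambda>n. metric_deriv h f (cis (a + s n))) \<longlonglongrightarrow> metric_deriv h f (cis a)"
    proof -
      have "(\<lambda>n. a + s n) \<longlonglongrightarrow> a + 0"
        by (intro tendsto_intros lim_s)
      then have "(\<lambda>n. a + s n) \<longlonglongrightarrow> a"
        by simp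
      then show ?thesis
        by (rule isCont_tendsto_compose[OF isCont_metric_deriv_cis[OF h in_C2[OF f]]])
    qed
    then have "(\<lambda>n. metric_deriv h f (cis (a + s n)) * ?D (g (r n))) \<longlonglongrightarrow> metric_deriv h f (cis a) * M"
      using LIMSEQ_subseq_LIMSEQ[OF lim_M y(2)] by (intro tendsto_mult) (auto simp: o_def)
    ultimately have "metric_deriv h f y * M \<le> M"
      unfolding a by (intro LIMSEQ_le_const2[of _ _ M]) auto
    then show ?thesis
      using M by simp
  qed
  then have NE: "y \<in> \<Lambda> \<inter> NE h G"
    using y yc by (simp add: NE_def)
  show ?thesis
  proof (cases "\<exists>n. g (r n) x = y")
    case True
    then show ?thesis
      using g(1) NE by metis
  next
    case False
    then have s_nz: "s n \<noteq> 0" for n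
      using y_s[of n] a by auto
    \<comment> \<open>Chosen so that \<open>K\<close> times the lower bound
      \<open>M * m1 / (2 * m2)\<close> for the speed of \<open>g (r n)\<close> at \<open>x\<close>
      is \<open>C + 1\<close>.\<close>
    define K where "K = (C + 1) * (2 * m2 / (M * m1))"
    have "\<exists>\<delta>>0. \<forall>t. 0 < t \<and> t < \<delta> \<longrightarrow> (\<exists>q\<in>G. K \<le> speed q (cis (a + \<sigma> * t)))"
      if "\<sigma> = 1 \<or> \<sigma> = - 1" for \<sigma>
      using star NE that escape[of _ \<sigma> a] unfolding property_star_iff a by blast
    from this[of 1] this[of "- 1"] obtain \<delta>p \<delta>m where \<delta>: "\<delta>p > 0" "\<delta>m > 0"
      and p: "\<And>t. 0 < t \<Longrightarrow> t < \<delta>p \<Longrightarrow> \<exists>q\<in>G. K \<le> speed q (cis (a + 1 * t))"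
      and m': "\<And>t. 0 < t \<Longrightarrow> t < \<delta>m \<Longrightarrow> \<exists>q\<in>G. K \<le> speed q (cis (a + - 1 * t))"
      by auto
    have "\<forall>\<^sub>F n in sequentially. \<bar>s n\<bar> < min \<delta>p \<delta>m"
      using tendstoD[OF lim_s, of "min \<delta>p \<delta>m"] \<delta> by (simp add: dist_real_def)
    then obtain n where n: "\<bar>s n\<bar> < min \<delta>p \<delta>m"
      using eventually_happens trivial_limit_sequentially by blast
    \<comment> \<open>The sign of \<open>s n\<close> tells on which side of \<open>y\<close> the
      orbit point lies.\<close>
    have "\<exists>q\<in>G. K \<le> speed q (cis (a + s n))"
      using p[of "s n"] m'[of "- s n"] n s_nz[of n] by (cases "s n > 0") auto
    then obtain q where q: "q \<in> G" "K \<le> speed q (g (r n) x)"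
      by (auto simp: y_s)
    have "M / 2 \<le> speed (g (r n)) x * (m2 / m1)"
      using half[of "r n"] D_le[OF g(1), of "r n"] by linarith
    then have sp: "M * m1 / (2 * m2) \<le> speed (g (r n)) x"
      using m(1) m2 by (simp add: field_simps)
    have "0 < speed (g (r n)) x"
      by (rule speed_pos[OF in_C2[OF g(1)] xc])
    then have "0 \<le> C"
      using C[OF g(1), of "r n"] by linarith
    \<comment> \<open>Escaping after \<open>g (r n)\<close> gives a group element of speed at least
      \<open>C + 1\<close> at \<open>x\<close>, a contradiction.\<close>
    have "C + 1 = K * (M * m1 / (2 * m2))"
      using M m(1) m2 by (simp add: K_def)
    also have "\<dots> \<le> speed q (g (r n) x) * speed (g (r n)) x"
      using q(2) sp M m(1) m2 \<open>0 \<le> C\<close> speed_pos[OF in_C2[OF q(1)] mem_circle[OF g(1) xc], of "r n"]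
      by (intro mult_mono) (simp_all add: less_imp_le)
    also have "\<dots> = speed (compose circle q (g (r n))) x"
      by (rule speed_compose[OF in_C2[OF q(1)] in_C2[OF g(1)] xc, symmetric])
    also have "\<dots> \<le> C"
      by (rule C[OF compose_mem[OF q(1) g(1)]])
    finally show ?thesis by simp
  qed
qed

text \<open>Comparability with the Euclidean metric turns non-expandability for any metric into the
  metric-free bound that \<open>orbit_meets_NE\<close> assumes.\<close>

lemma speed_bounded_NE:
  assumes h: "riemannian_metric h" and x: "x \<in> NE h G"
  obtains C where "\<And>g. g \<in> G \<Longrightarrow> speed g x \<le> C"
proof -
  have xc: "x \<in> circle"
    using x by (simp add: NE_def)
  obtain m1 m2 where m: "0 < m1" "\<And>z. z \<in> circle \<Longrightarrow> m1 \<le> metric_density h z"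
      "\<And>z. z \<in> circle \<Longrightarrow> metric_density h z \<le> m2"
    using metric_density_bounds[OF h] by metis
  have "speed g x \<le> m2 / m1" if g: "g \<in> G" for g
  proof -
    have "metric_deriv h g x \<le> 1"
      using x g by (simp add: NE_def)
    then have "speed g x * metric_density h (g x) \<le> m2"
      using m(3)[OF xc] metric_density_pos[OF h xc]
      by (simp add: metric_deriv_eq[OF h in_C2[OF g] xc])
    moreover have "speed g x * m1 \<le> speed g x * metric_density h (g x)"
      using m(2)[OF mem_circle[OF g xc]] speed_pos[OF in_C2[OF g] xc]
      by (intro mult_left_mono) auto
    ultimately show ?thesis
      using m(1) by (simp add: field_simps)
  qed
  then show ?thesis
    by (rule that)
qed

end

section \<open>Change of metric\<close>

theorem corollary1p13:
  fixes G :: "(complex \<Rightarrow> complex) set"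
    and \<Lambda> :: "complex set"
    and h h' :: "complex \<Rightarrow> complex \<Rightarrow> complex \<Rightarrow> real"
  assumes "fg_C2_circle_group G"
    and "exceptional_minimal_set G \<Lambda>"
    and "riemannian_metric h"
    and "property_star h G \<Lambda>"
    and "riemannian_metric h'"
  shows "property_star h' G \<Lambda>"
proof -
  interpret C2_circle_group G
    using assms(1) by (simp add: C2_circle_group_def fg_C2_circle_group_def)
  have \<Lambda>: "closed \<Lambda>" "\<Lambda> \<subseteq> circle" "\<And>g. g \<in> G \<Longrightarrow> g ` \<Lambda> = \<Lambda>"
    using assms(2) by (auto simp: exceptional_minimal_set_def nonempty_closed_invariant_def)
  \<comment> \<open>\<open>h'\<close> supplies the speed bound at \<open>x\<close>, \<open>h\<close>
    supplies the isolating element at some \<open>g x\<close>, and conjugation by \<open>g\<close>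
    brings it back to \<open>x\<close> on the same side.\<close>
  have "\<exists>f\<in>G. isolating \<sigma> f x" if x: "x \<in> \<Lambda>" "x \<in> NE h' G" and \<sigma>: "\<sigma> = 1 \<or> \<sigma> = - 1" for x \<sigma>
  proof -
    obtain C where C: "\<And>g. g \<in> G \<Longrightarrow> speed g x \<le> C"
      using speed_bounded_NE[OF assms(5) x(2)] by metis
    obtain g where g: "g \<in> G" "g x \<in> \<Lambda> \<inter> NE h G"
      using orbit_meets_NE[OF assms(3,4) \<Lambda> x(1) C] by blast
    then obtain f where "f \<in> G" "isolating \<sigma> f (g x)"
      using assms(4) \<sigma> unfolding property_star_iff by blast
    then show ?thesis
      using isolating_conjugate[OF g(1) _ _ _ \<sigma>] x(1) \<Lambda>(2) by blast
  qed
  then show ?thesis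
    unfolding property_star_iff by blast
qed

end
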